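(* Let $h\in L^1(\mathbb{R}^n)$, let $\emptyset\ne I'\subseteq\mathbb{R}^n$ be unbounded, let $c\in\mathbb{C}\setminus\{0\}$, and let $F:\mathbb{R}^n\times X\to Y$ be a continuous function such that for each $B\in\mathcal{B}$ there exists a finite real number $\epsilon_B>0$ with $\sup_{\mathbf{t}\in\mathbb{R}^n,x\in B^{\cdot}}\|F(\mathbf{t};x)\|_Y<+\infty$, where $B^{\cdot}:=B^\circ\cup\bigcup_{y\in\partial B}B(y,\epsilon_B)$. Then the function $$(h\ast F)(\mathbf{t};x):=\int_{\mathbb{R}^n}h(\sigma)F(\mathbf{t}-\sigma;x)\,d\sigma,\qquad\mathbf{t}\in\mathbb{R}^n,\ x\in X,$$ is well defined and for each $B\in\mathcal{B}$ we have $\sup_{\mathbf{t}\in\mathbb{R}^n,x\in B^{\cdot}}\|(h\ast F)(\mathbf{t};x)\|_Y<+\infty$. Furthermore, if $F$ is $\mathbb{R}^n$-quasi-asymptotically $(\mathcal{B},I',c)$-almost periodic, resp. $\mathbb{R}^n$-quasi-asymptotically $(\mathcal{B},I',c)$-uniformly recurrent, then $h\ast F$ is likewise $\mathbb{R}^n$-quasi-asymptotically $(\mathcal{B},I',c)$-almost periodic, resp. $\mathbb{R}^n$-quasi-asymptotically $(\mathcal{B},I',c)$-uniformly recurrent.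
   Context: $X,Y$ are complex Banach spaces. $\mathcal{B}$ is a collection of non-empty subsets of $X$ such that every $x\in X$ belongs to some $B\in\mathcal{B}$. $B^\circ$ and $\partial B$ are interior and boundary of $B$ in $X$; $B(\cdot,r)$ denotes closed balls (in $X$ or, for the Euclidean norm $|\cdot|$, in $\mathbb{R}^n$). A continuous $G:\mathbb{R}^n\times X\to Y$ is $\mathbb{R}^n$-quasi-asymptotically $(\mathcal{B},I',c)$-almost periodic if for every $B\in\mathcal{B}$ and $\epsilon>0$ there exists $l>0$ such that for each $\mathbf{t}_0\in I'$ there exist $\tau\in B(\mathbf{t}_0,l)\cap I'$ and a finite real number $M(\epsilon,\tau)>0$ such that $\|G(\mathbf{t}+\tau;x)-cG(\mathbf{t};x)\|_Y\le\epsilon$ whenever $|\mathbf{t}|\ge M(\epsilon,\tau)$, $|\mathbf{t}+\tau|\ge M(\epsilon,\tau)$ and $x\in B$. It is $\mathbb{R}^n$-quasi-asymptotically $(\mathcal{B},I',c)$-uniformly recurrent if for every $B\in\mathcal{B}$ there exist a sequence $(\tau_k)$ in $I'$ and a sequence $(M_k)$ in $(0,\infty)$ with $\lim_k|\tau_k|=\lim_kM_k=+\infty$ and $\lim_{k\to+\infty}\sup_{|\mathbf{t}|\ge M_k,\,|\mathbf{t}+\tau_k|\ge M_k;\,x\in B}\|G(\mathbf{t}+\tau_k;x)-cG(\mathbf{t};x)\|_Y=0$. *)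

theory Defs
  imports "HOL-Analysis.Analysis"
begin

section \<open>Complex Banach spaces\<close>

class complex_normed_vector = real_normed_vector +
  fixes scaleC :: "complex \<Rightarrow> 'a \<Rightarrow> 'a"  (infixr \<open>*\<^sub>C\<close> 75)
  assumes scaleC_add_right: "a *\<^sub>C (x + y) = a *\<^sub>C x + a *\<^sub>C y"
    and scaleC_add_left: "(a + b) *\<^sub>C x = a *\<^sub>C x + b *\<^sub>C x"
    and scaleC_scaleC: "a *\<^sub>C (b *\<^sub>C x) = (a * b) *\<^sub>C x"
    and scaleC_of_real: "complex_of_real r *\<^sub>C x = r *\<^sub>R x"
    and norm_scaleC: "norm (a *\<^sub>C x) = cmod a * norm x"

class complex_banach = complex_normed_vector + banach

instantiation complex :: complex_banach
begin

definition scaleC_complex :: "complex \<Rightarrow> complex \<Rightarrow> complex"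
  where "scaleC_complex a x = a * x"

instance
  by standard (simp_all add: scaleC_complex_def algebra_simps norm_mult scaleR_conv_of_real)

end

section \<open>The Bochner integral in arbitrary Banach spaces\<close>

text \<open>
  The Bochner integral of the library is only available for values in a second countable (that is,
  separable) space. The following is its definition without this restriction;
  approximability in the mean by simple functions forces the integrand to be
  almost everywhere separably valued. The two notions agree where both make sense.
\<close>

definition has_bochner_int :: "'a measure \<Rightarrow> ('a \<Rightarrow> 'b::real_normed_vector) \<Rightarrow> 'b \<Rightarrow> bool"
  where "has_bochner_int M f x \<longleftrightarrow>
    f \<in> borel_measurable M \<and>
    (\<exists>s :: nat \<Rightarrow> 'a \<Rightarrow> 'b. (\<forall>i. Bochner_Integration.simple_bochner_integrable M (s i)) \<and>
      (\<lambda>i. \<integral>\<^sup>+ y. ennreal (norm (f y - s i y)) \<partial>M) \<longlonglongrightarrow> 0 \<and>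
      (\<lambda>i. Bochner_Integration.simple_bochner_integral M (s i)) \<longlonglongrightarrow> x)"

definition bochner_integrable :: "'a measure \<Rightarrow> ('a \<Rightarrow> 'b::real_normed_vector) \<Rightarrow> bool"
  where "bochner_integrable M f \<longleftrightarrow> (\<exists>x. has_bochner_int M f x)"

definition bochner_int :: "'a measure \<Rightarrow> ('a \<Rightarrow> 'b::real_normed_vector) \<Rightarrow> 'b"
  where "bochner_int M f =
    (if bochner_integrable M f then THE x. has_bochner_int M f x else 0)"

lemma has_bochner_int_eq:
  fixes f :: "'a \<Rightarrow> 'b::{real_normed_vector, second_countable_topology}"
  shows "has_bochner_int M f x \<longleftrightarrow> has_bochner_integral M f x"
  unfolding has_bochner_int_def has_bochner_integral.simps by auto

lemma bochner_integrable_eq: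
  fixes f :: "'a \<Rightarrow> 'b::{real_normed_vector, second_countable_topology}"
  shows "bochner_integrable M f \<longleftrightarrow> integrable M f"
  unfolding bochner_integrable_def integrable.simps has_bochner_int_eq ..

lemma bochner_int_eq:
  fixes f :: "'a \<Rightarrow> 'b::{real_normed_vector, second_countable_topology}"
  shows "bochner_int M f = integral\<^sup>L M f"
  unfolding bochner_int_def lebesgue_integral_def bochner_integrable_def has_bochner_int_eq ..

section \<open>Convolution and quasi-asymptotic almost periodicity\<close>

definition convolution ::
  "(real ^ 'n \<Rightarrow> complex) \<Rightarrow> ((real ^ 'n) \<times> 'x \<Rightarrow> 'y::complex_banach) \<Rightarrow> (real ^ 'n) \<times> 'x \<Rightarrow> 'y"
  where "convolution h F = (\<lambda>(t, x). bochner_int lebesgue (\<lambda>\<sigma>. h \<sigma> *\<^sub>C F (t - \<sigma>, x)))"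

definition enlargement :: "real \<Rightarrow> 'x::metric_space set \<Rightarrow> 'x set"
  where "enlargement e B = interior B \<union> (\<Union>y\<in>frontier B. cball y e)"

text \<open>Suprema of norms are taken in \<^typ>\<open>ennreal\<close>, so that they are meaningful for unbounded
  functions as well.\<close>

definition quasi_asymptotically_almost_periodic ::
  "'x::complex_banach set set \<Rightarrow> (real ^ 'n) set \<Rightarrow> complex \<Rightarrow>
    ((real ^ 'n) \<times> 'x \<Rightarrow> 'y::complex_banach) \<Rightarrow> bool"
  where "quasi_asymptotically_almost_periodic \<B> I' c G \<longleftrightarrow>
    continuous_on UNIV G \<and>
    (\<forall>B\<in>\<B>. \<forall>\<epsilon>>0. \<exists>l>0. \<forall>t\<^sub>0\<in>I'. \<exists>\<tau>\<in>cball t\<^sub>0 l \<inter> I'. \<exists>M>0.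
      \<forall>t. \<forall>x\<in>B. norm t \<ge> M \<and> norm (t + \<tau>) \<ge> M \<longrightarrow>
        norm (G (t + \<tau>, x) - c *\<^sub>C G (t, x)) \<le> \<epsilon>)"

definition quasi_asymptotically_uniformly_recurrent ::
  "'x::complex_banach set set \<Rightarrow> (real ^ 'n) set \<Rightarrow> complex \<Rightarrow>
    ((real ^ 'n) \<times> 'x \<Rightarrow> 'y::complex_banach) \<Rightarrow> bool"
  where "quasi_asymptotically_uniformly_recurrent \<B> I' c G \<longleftrightarrow>
    continuous_on UNIV G \<and>
    (\<forall>B\<in>\<B>. \<exists>\<tau> :: nat \<Rightarrow> real ^ 'n. \<exists>M :: nat \<Rightarrow> real.
      (\<forall>k. \<tau> k \<in> I') \<and> (\<forall>k. M k > 0) \<and>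
      filterlim (\<lambda>k. norm (\<tau> k)) at_top sequentially \<and>
      filterlim M at_top sequentially \<and>
      (\<lambda>k. SUP (t, x) \<in> {t. norm t \<ge> M k \<and> norm (t + \<tau> k) \<ge> M k} \<times> B.
        ennreal (norm (G (t + \<tau> k, x) - c *\<^sub>C G (t, x)))) \<longlonglongrightarrow> 0)"

end

theory Submission
  imports Defs
begin

text \<open>
  The error \<open>F (t + \<tau> - \<sigma>, x) - c *\<^sub>C F (t - \<sigma>, x)\<close> is small as soon as both \<open>t - \<sigma>\<close> and
  \<open>t + \<tau> - \<sigma>\<close> are far from the origin. Enlarging the threshold \<open>M\<close> of \<open>F\<close> to \<open>M + R\<close> makes this
  true for all \<open>\<sigma>\<close> with \<open>norm \<sigma> < R\<close>; on the remaining \<open>\<sigma>\<close> the error is bounded because \<open>F\<close> is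
  bounded on \<open>B\<close>, and the integral of \<open>\<bar>h\<bar>\<close> there tends to 0 as \<open>R\<close> grows. Continuity of the
  convolution is dominated convergence, and this is where boundedness on the enlargement of \<open>B\<close>
  enters: it yields a common bound on a neighbourhood of each point of \<open>B\<close>. Since \<open>Y\<close> need not
  be separable, integrability is obtained from explicit simple approximations: evaluate the
  continuous factor along simple functions converging to the identity.
\<close>

section \<open>Bochner integrals with values in a possibly non-separable space\<close>

lemma simple_bochner_integrable_simple_function:
  "Bochner_Integration.simple_bochner_integrable M s \<Longrightarrow> simple_function M s"
  by (auto elim: Bochner_Integration.simple_bochner_integrable.cases)

text \<open>In a non-separable space the difference of two Borel functions need not be Borel.\<close>

lemma borel_measurable_diff_simple_function:
  fixes f :: "'a \<Rightarrow> 'b::real_normed_vector"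
  assumes f: "f \<in> borel_measurable M" and s: "simple_function M s"
  shows "(\<lambda>w. f w - s w) \<in> borel_measurable M"
\<comment> \<open>On each of the finitely many level sets of \<open>s\<close> the difference is
  \<open>f\<close> minus a constant \<open>v\<close>, a continuous image of
  \<open>f\<close>.\<close>
proof (rule measurable_compose_countable'[where g = s and I = "s ` space M" and f = "\<lambda>v w. f w - v"])
  show "(\<lambda>w. f w - v) \<in> borel_measurable M" for v
    by (rule borel_measurable_continuous_on[OF _ f]) (intro continuous_intros)
  show "s \<in> measurable M (count_space (s ` space M))"
    using s by (auto simp: measurable_count_space_eq2 simple_function_def)
  show "countable (s ` space M)"
    using s by (auto simp: simple_function_def intro: countable_finite)
qed

lemma borel_measurable_ennreal_norm:
  "g \<in> borel_measurable M \<Longrightarrow> (\<lambda>w. ennreal (norm (g w :: 'b::real_normed_vector))) \<in> borel_measurable M"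
  by measurable

text \<open>Pointwise, \<open>s - u\<close> splits into \<open>f - g\<close> and the two
  approximation errors. The majorant \<open>p\<close> stands in for the norm of
  \<open>f - g\<close>, which need not be measurable. The case \<open>f = g\<close>,
  \<open>p = 0\<close> yields the Cauchy property of approximating integrals.\<close>

lemma simple_bochner_integral_norm_diff_le:
  fixes f g :: "'a \<Rightarrow> 'b::real_normed_vector"
  assumes f: "f \<in> borel_measurable M" and g: "g \<in> borel_measurable M"
    and s: "Bochner_Integration.simple_bochner_integrable M s"
    and u: "Bochner_Integration.simple_bochner_integrable M u"
    and p: "p \<in> borel_measurable M" "\<And>w. w \<in> space M \<Longrightarrow> norm (f w - g w) \<le> p w"
  shows "ennreal (norm (Bochner_Integration.simple_bochner_integral M s -
        Bochner_Integration.simple_bochner_integral M u)) \<le>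
    (\<integral>\<^sup>+ w. ennreal (norm (f w - s w)) \<partial>M) + (\<integral>\<^sup>+ w. ennreal (p w) \<partial>M) +
    (\<integral>\<^sup>+ w. ennreal (norm (g w - u w)) \<partial>M)"
proof -
  let ?I = "Bochner_Integration.simple_bochner_integral M"
  note su = simple_bochner_integrable_simple_function[OF s] simple_bochner_integrable_simple_function[OF u]
  have [measurable]: "(\<lambda>w. f w - s w) \<in> borel_measurable M" "(\<lambda>w. g w - u w) \<in> borel_measurable M"
    "p \<in> borel_measurable M"
    by (simp_all add: borel_measurable_diff_simple_function f g su p)
  have "ennreal (norm (?I s - ?I u)) = norm (?I (\<lambda>w. s w - u w))"
    by (simp add: Bochner_Integration.simple_bochner_integral_diff s u)
  also have "\<dots> \<le> ?I (\<lambda>w. norm (s w - u w))"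
    using Bochner_Integration.simple_bochner_integrable_compose2[of "(-)" M s u] s u
    by (auto intro!: Bochner_Integration.simple_bochner_integral_norm_bound)
  also have "\<dots> = (\<integral>\<^sup>+ w. norm (s w - u w) \<partial>M)"
    using Bochner_Integration.simple_bochner_integrable_compose2[of "\<lambda>x y. norm (x - y)" M s u] s u
    by (auto intro!: Bochner_Integration.simple_bochner_integral_eq_nn_integral)
  also have "\<dots> \<le> (\<integral>\<^sup>+ w. (ennreal (norm (f w - s w)) + ennreal (p w)) + ennreal (norm (g w - u w)) \<partial>M)"
  proof (rule nn_integral_mono)
    fix w assume w: "w \<in> space M"
    have eq: "s w - u w = (f w - g w) - (f w - s w) + (g w - u w)"
      by simp
    have "norm (s w - u w) \<le> norm (f w - s w) + norm (f w - g w) + norm (g w - u w)"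
      unfolding eq using norm_triangle_ineq[of "(f w - g w) - (f w - s w)" "g w - u w"]
        norm_triangle_ineq4[of "f w - g w" "f w - s w"] by linarith
    also have "\<dots> \<le> norm (f w - s w) + p w + norm (g w - u w)"
      using p(2)[OF w] by simp
    finally show "ennreal (norm (s w - u w)) \<le> ennreal (norm (f w - s w)) + ennreal (p w) + ennreal (norm (g w - u w))"
      using order_trans[OF norm_ge_zero p(2)[OF w]] by (simp flip: ennreal_plus)
  qed
  also have "\<dots> = (\<integral>\<^sup>+ w. ennreal (norm (f w - s w)) \<partial>M) + (\<integral>\<^sup>+ w. ennreal (p w) \<partial>M) +
    (\<integral>\<^sup>+ w. ennreal (norm (g w - u w)) \<partial>M)"
    by (simp add: nn_integral_add)
  finally show ?thesis .
qed

text \<open>The preceding estimate in the limit, where the approximation errors vanish. It gives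
  uniqueness for \<open>f = g\<close>, norm bounds for \<open>g = 0\<close>, and comparisons of
  convolutions, all without integrating \<open>f - g\<close> itself.\<close>

lemma has_bochner_int_norm_diff_le:
  fixes f g :: "'a \<Rightarrow> 'b::real_normed_vector"
  assumes f: "has_bochner_int M f x" and g: "has_bochner_int M g y"
    and p: "integrable M p" "\<And>w. w \<in> space M \<Longrightarrow> norm (f w - g w) \<le> p w"
  shows "norm (x - y) \<le> (\<integral>w. p w \<partial>M)"
proof -
  let ?I = "Bochner_Integration.simple_bochner_integral M"
  obtain s where s: "\<And>i. Bochner_Integration.simple_bochner_integrable M (s i)"
    "(\<lambda>i. \<integral>\<^sup>+ w. ennreal (norm (f w - s i w)) \<partial>M) \<longlonglongrightarrow> 0" "(\<lambda>i. ?I (s i)) \<longlonglongrightarrow> x"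
    and fm: "f \<in> borel_measurable M"
    using f unfolding has_bochner_int_def by auto
  obtain u where u: "\<And>i. Bochner_Integration.simple_bochner_integrable M (u i)"
    "(\<lambda>i. \<integral>\<^sup>+ w. ennreal (norm (g w - u i w)) \<partial>M) \<longlonglongrightarrow> 0" "(\<lambda>i. ?I (u i)) \<longlonglongrightarrow> y"
    and gm: "g \<in> borel_measurable M"
    using g unfolding has_bochner_int_def by auto
  have p0: "0 \<le> p w" if "w \<in> space M" for w
    using order_trans[OF norm_ge_zero p(2)[OF that]] .
  have "(\<lambda>i. (\<integral>\<^sup>+ w. ennreal (norm (f w - s i w)) \<partial>M) + (\<integral>\<^sup>+ w. ennreal (p w) \<partial>M) +
    (\<integral>\<^sup>+ w. ennreal (norm (g w - u i w)) \<partial>M)) \<longlonglongrightarrow> 0 + (\<integral>\<^sup>+ w. ennreal (p w) \<partial>M) + 0"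
    by (intro tendsto_add s u tendsto_const)
  moreover have "(\<lambda>i. ennreal (norm (?I (s i) - ?I (u i)))) \<longlonglongrightarrow> ennreal (norm (x - y))"
    by (intro tendsto_ennrealI tendsto_norm tendsto_diff s u)
  moreover have "\<forall>i. ennreal (norm (?I (s i) - ?I (u i))) \<le>
    (\<integral>\<^sup>+ w. ennreal (norm (f w - s i w)) \<partial>M) + (\<integral>\<^sup>+ w. ennreal (p w) \<partial>M) +
    (\<integral>\<^sup>+ w. ennreal (norm (g w - u i w)) \<partial>M)"
    using simple_bochner_integral_norm_diff_le[OF fm gm s(1) u(1) borel_measurable_integrable[OF p(1)] p(2)] by blast
  ultimately have "ennreal (norm (x - y)) \<le> 0 + (\<integral>\<^sup>+ w. ennreal (p w) \<partial>M) + 0"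
    by (rule tendsto_le[OF sequentially_bot _ _ always_eventually])
  also have "0 + (\<integral>\<^sup>+ w. ennreal (p w) \<partial>M) + 0 = ennreal (\<integral>w. p w \<partial>M)"
    using nn_integral_eq_integral[OF p(1) AE_I2[OF p0]] by simp
  finally have "ennreal (norm (x - y)) \<le> ennreal (\<integral>w. p w \<partial>M)" .
  \<comment> \<open>\<open>ennreal\<close> sends negative reals to 0, so the inequality returns to
    the reals only with a nonnegative right-hand side.\<close>
  moreover have "0 \<le> (\<integral>w. p w \<partial>M)"
    by (intro integral_nonneg_AE AE_I2 p0)
  ultimately show ?thesis
    by (simp only: ennreal_le_iff)
qed

lemma has_bochner_int_unique:
  assumes "has_bochner_int M f x" "has_bochner_int M f y"
  shows "x = y"
  using has_bochner_int_norm_diff_le[OF assms integrable_zero] by simp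

lemma has_bochner_int_bochner_int:
  assumes "bochner_integrable M f"
  shows "has_bochner_int M f (bochner_int M f)"
proof -
  obtain x where x: "has_bochner_int M f x"
    using assms unfolding bochner_integrable_def by blast
  have "has_bochner_int M f (THE x. has_bochner_int M f x)"
    by (rule theI[of "has_bochner_int M f" x, OF x]) (rule has_bochner_int_unique[OF _ x])
  then show ?thesis
    using assms by (simp add: bochner_int_def)
qed

lemma has_bochner_int_zero: "has_bochner_int M (\<lambda>_. 0 :: 'b::real_normed_vector) 0"
proof -
  have "Bochner_Integration.simple_bochner_integral M (\<lambda>_. 0 :: 'b) = 0"
    unfolding Bochner_Integration.simple_bochner_integral_def by (rule sum.neutral) auto
  moreover have "Bochner_Integration.simple_bochner_integrable M (\<lambda>_. 0 :: 'b)"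
    by (rule Bochner_Integration.simple_bochner_integrableI_bounded) auto
  ultimately show ?thesis
    unfolding has_bochner_int_def by (intro conjI exI[of _ "\<lambda>_ _. 0"]) simp_all
qed

text \<open>Applying \<open>T\<close> to the simple approximants enlarges their error by at most the
  operator bound \<open>K\<close>. This is what moves the factor \<open>c\<close> under the
  integral.\<close>

lemma has_bochner_int_bounded_linear:
  fixes f :: "'a \<Rightarrow> 'b::real_normed_vector" and T :: "'b \<Rightarrow> 'c::real_normed_vector"
  assumes T: "bounded_linear T" and f: "has_bochner_int M f x"
  shows "has_bochner_int M (\<lambda>w. T (f w)) (T x)"
proof -
  let ?I = "Bochner_Integration.simple_bochner_integral M"
  interpret T: bounded_linear T by fact
  obtain K where K: "K > 0" "\<And>v. norm (T v) \<le> norm v * K"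
    using T.pos_bounded by blast
  obtain s where s: "\<And>i. Bochner_Integration.simple_bochner_integrable M (s i)"
    "(\<lambda>i. \<integral>\<^sup>+ w. ennreal (norm (f w - s i w)) \<partial>M) \<longlonglongrightarrow> 0" "(\<lambda>i. ?I (s i)) \<longlonglongrightarrow> x"
    and fm: "f \<in> borel_measurable M"
    using f unfolding has_bochner_int_def by auto
  have [measurable]: "(\<lambda>w. f w - s i w) \<in> borel_measurable M" for i
    by (simp add: borel_measurable_diff_simple_function fm simple_bochner_integrable_simple_function s)
  show ?thesis
    unfolding has_bochner_int_def
  proof (intro conjI exI[of _ "\<lambda>i w. T (s i w)"] allI)
    show "(\<lambda>w. T (f w)) \<in> borel_measurable M"
      by (rule borel_measurable_continuous_on[OF _ fm]) (simp add: T.continuous_on)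
    \<comment> \<open>The composition rule is for two arguments; the second copy of
      \<open>s i\<close> is ignored.\<close>
    show "Bochner_Integration.simple_bochner_integrable M (\<lambda>w. T (s i w))" for i
      using Bochner_Integration.simple_bochner_integrable_compose2[of "\<lambda>a b. T a" M "s i" "s i"] s
      by (simp add: T.zero)
    have le: "(\<integral>\<^sup>+ w. ennreal (norm (T (f w) - T (s i w))) \<partial>M) \<le> ennreal K * (\<integral>\<^sup>+ w. ennreal (norm (f w - s i w)) \<partial>M)" for i
    proof -
      have "(\<integral>\<^sup>+ w. ennreal (norm (T (f w) - T (s i w))) \<partial>M) \<le> (\<integral>\<^sup>+ w. ennreal K * ennreal (norm (f w - s i w)) \<partial>M)"
        using K by (intro nn_integral_mono) (simp add: mult.commute flip: T.diff ennreal_mult')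
      then show ?thesis
        by (simp add: nn_integral_cmult)
    qed
    have lim: "(\<lambda>i. ennreal K * (\<integral>\<^sup>+ w. ennreal (norm (f w - s i w)) \<partial>M)) \<longlonglongrightarrow> 0"
      using ennreal_tendsto_cmult[OF ennreal_less_top s(2), of K] by simp
    show "(\<lambda>i. \<integral>\<^sup>+ w. ennreal (norm (T (f w) - T (s i w))) \<partial>M) \<longlonglongrightarrow> 0"
    proof (rule tendsto_sandwich[OF _ _ tendsto_const lim])
      show "\<forall>\<^sub>F i in sequentially. (\<integral>\<^sup>+ w. ennreal (norm (T (f w) - T (s i w))) \<partial>M)
          \<le> ennreal K * (\<integral>\<^sup>+ w. ennreal (norm (f w - s i w)) \<partial>M)"
        by (intro always_eventually allI le)
    qed simp
    show "(\<lambda>i. ?I (\<lambda>w. T (s i w))) \<longlonglongrightarrow> T x"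
      using T.tendsto[OF s(3)] by (simp add: Bochner_Integration.simple_bochner_integral_linear s T.linear_axioms)
  qed
qed

text \<open>The bound \<open>p\<close> passes to \<open>f\<close>, so scalar dominated convergence
  gives approximation in the mean. The integrals of the \<open>s i\<close> are then Cauchy, and
  completeness supplies the value.\<close>

lemma bochner_integrable_dominated:
  fixes f :: "'a \<Rightarrow> 'b::banach"
  assumes s: "\<And>i. simple_function M (s i)"
    and lim: "\<And>w. w \<in> space M \<Longrightarrow> (\<lambda>i. s i w) \<longlonglongrightarrow> f w"
    and p: "integrable M p" "\<And>i w. w \<in> space M \<Longrightarrow> norm (s i w) \<le> p w"
  shows "bochner_integrable M f"
proof -
  let ?I = "Bochner_Integration.simple_bochner_integral M"
  have fm: "f \<in> borel_measurable M"
    by (rule borel_measurable_LIMSEQ_metric[where f = s])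
      (auto intro: s lim borel_measurable_simple_function)
  have [measurable]: "(\<lambda>w. f w - s i w) \<in> borel_measurable M" for i
    by (simp add: borel_measurable_diff_simple_function fm s)
  have p_fin: "(\<integral>\<^sup>+ w. ennreal (p w) \<partial>M) < \<infinity>"
    using integrableD(2)[OF p(1)] by (simp add: less_top)
  have p2_fin: "(\<integral>\<^sup>+ w. ennreal (2 * p w) \<partial>M) < \<infinity>"
    using integrableD(2)[OF integrable_mult_right[OF p(1), of 2]] by (simp add: less_top)
  have si: "Bochner_Integration.simple_bochner_integrable M (s i)" for i
    by (rule Bochner_Integration.simple_bochner_integrableI_bounded[OF s])
      (rule le_less_trans[OF nn_integral_mono p_fin], simp add: p ennreal_leI)
  have fp: "norm (f w) \<le> p w" if "w \<in> space M" for w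
    by (rule LIMSEQ_le_const2[OF tendsto_norm[OF lim[OF that]]]) (use p(2) that in auto)
  let ?e = "\<lambda>i. \<integral>\<^sup>+ w. ennreal (norm (f w - s i w)) \<partial>M"
  have e: "?e \<longlonglongrightarrow> (\<integral>\<^sup>+ w. 0 \<partial>M)"
  proof (rule nn_integral_dominated_convergence[where w = "\<lambda>w. ennreal (2 * p w)"])
    show "AE w in M. ennreal (norm (f w - s i w)) \<le> ennreal (2 * p w)" for i
    proof (rule AE_I2, rule ennreal_leI)
      fix w assume "w \<in> space M"
      then show "norm (f w - s i w) \<le> 2 * p w"
        using norm_triangle_ineq4[of "f w" "s i w"] fp[of w] p(2)[of w i] by linarith
    qed
    show "AE w in M. (\<lambda>i. ennreal (norm (f w - s i w))) \<longlonglongrightarrow> 0"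
    proof (rule AE_I2)
      fix w assume "w \<in> space M"
      have "(\<lambda>i. ennreal (norm (f w - s i w))) \<longlonglongrightarrow> ennreal (norm (f w - f w))"
        by (intro tendsto_ennrealI tendsto_norm tendsto_diff tendsto_const lim) fact
      then show "(\<lambda>i. ennreal (norm (f w - s i w))) \<longlonglongrightarrow> 0" by simp
    qed
  qed (use p p2_fin in \<open>auto intro: borel_measurable_ennreal_norm\<close>)
  have "Cauchy (\<lambda>i. ?I (s i))"
  proof (rule metric_CauchyI)
    fix r :: real assume r: "r > 0"
    have "eventually (\<lambda>i. ?e i < ennreal (r / 2)) sequentially"
      using e r by (intro order_tendstoD(2)[of _ 0]) auto
    then obtain N where N: "\<And>i. i \<ge> N \<Longrightarrow> ?e i < ennreal (r / 2)"
      by (auto simp: eventually_sequentially)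
    have "dist (?I (s i)) (?I (s j)) < r" if "i \<ge> N" "j \<ge> N" for i j
    proof -
      \<comment> \<open>Both simple functions approximate the same \<open>f\<close>, so the middle
        term of the estimate is 0 and only the two errors remain.\<close>
      have "ennreal (norm (?I (s i) - ?I (s j))) \<le> ?e i + (\<integral>\<^sup>+ w. ennreal 0 \<partial>M) + ?e j"
        by (rule simple_bochner_integral_norm_diff_le[OF fm fm si si]) auto
      also have "\<dots> < ennreal (r / 2) + ennreal (r / 2)"
        using N[OF that(1)] N[OF that(2)] by (simp add: add_strict_mono)
      also have "\<dots> = ennreal r"
        using r by (simp flip: ennreal_plus)
      finally show ?thesis
        by (simp add: dist_norm ennreal_less_iff)
    qed
    then show "\<exists>N. \<forall>i\<ge>N. \<forall>j\<ge>N. dist (?I (s i)) (?I (s j)) < r" by blast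
  qed
  then obtain x where "(\<lambda>i. ?I (s i)) \<longlonglongrightarrow> x"
    by (auto simp: Cauchy_convergent_iff convergent_def)
  then show ?thesis
    unfolding bochner_integrable_def has_bochner_int_def using fm si e by auto
qed

section \<open>Complex scalar multiplication and integrability of the convolution integrand\<close>

lemma bounded_bilinear_scaleC:
  "bounded_bilinear (scaleC :: complex \<Rightarrow> 'a::complex_normed_vector \<Rightarrow> 'a)"
proof
  have *: "r *\<^sub>R b = complex_of_real r *\<^sub>C b" for r and b :: 'a
    by (rule scaleC_of_real[symmetric])
  show "(r *\<^sub>R a) *\<^sub>C b = r *\<^sub>R (a *\<^sub>C b)" for r a and b :: 'a
    unfolding * scaleC_scaleC scaleR_conv_of_real ..
  show "a *\<^sub>C (r *\<^sub>R b) = r *\<^sub>R (a *\<^sub>C b)" for r a and b :: 'a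
    unfolding * scaleC_scaleC by (rule arg_cong[OF mult.commute])
  show "\<exists>K. \<forall>a (b :: 'a). norm (a *\<^sub>C b) \<le> norm a * norm b * K"
    by (intro exI[of _ 1]) (simp add: norm_scaleC)
qed (simp_all add: scaleC_add_left scaleC_add_right)

text \<open>If simple functions \<open>r i\<close> tend to the identity, \<open>g (r i t)\<close>
  takes finitely many values and tends to \<open>g t\<close> by continuity, whatever the size of the
  target space. Multiplying by simple approximants of \<open>h\<close> gives simple functions
  dominated by \<open>2 * cmod (h t) * K\<close>.\<close>

lemma bochner_integrable_scaleC_continuous:
  fixes h :: "'a::euclidean_space \<Rightarrow> complex" and g :: "'a \<Rightarrow> 'b::complex_banach"
  assumes h: "integrable lebesgue h" and g: "continuous_on UNIV g" and K: "\<And>t. norm (g t) \<le> K"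
  shows "bochner_integrable lebesgue (\<lambda>t. h t *\<^sub>C g t)"
proof -
  have hm: "h \<in> borel_measurable lebesgue"
    using h by auto
  \<comment> \<open>Approximation relative to the base point 0 keeps \<open>a i t\<close> within
    twice the modulus of \<open>h t\<close>, which is what makes the majorant integrable.\<close>
  obtain a where a: "\<And>i. simple_function lebesgue (a i)" "\<And>t. (\<lambda>i. a i t) \<longlonglongrightarrow> h t"
    "\<And>i t. cmod (a i t) \<le> 2 * cmod (h t)"
    using borel_measurable_implies_sequence_metric[OF hm, of 0] by simp metis
  have "(\<lambda>t::'a. t) \<in> borel_measurable lebesgue"
    by (rule measurable_completion) simp
  then obtain r :: "nat \<Rightarrow> 'a \<Rightarrow> 'a" where r: "\<And>i. simple_function lebesgue (r i)" "\<And>t. (\<lambda>i. r i t) \<longlonglongrightarrow> t"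
    using borel_measurable_implies_sequence_metric[of "\<lambda>t::'a. t" lebesgue 0] by simp metis
  show ?thesis
  proof (rule bochner_integrable_dominated)
    show "simple_function lebesgue (\<lambda>t. a i t *\<^sub>C g (r i t))" for i
      by (rule simple_function_compose2[OF a(1) r(1)])
    show "(\<lambda>i. a i t *\<^sub>C g (r i t)) \<longlonglongrightarrow> h t *\<^sub>C g t" for t
      by (intro bounded_bilinear.tendsto[OF bounded_bilinear_scaleC] a
          continuous_on_tendsto_compose[OF g r(2)]) auto
    show "integrable lebesgue (\<lambda>t. 2 * cmod (h t) * K)"
      using h by auto
    show "norm (a i t *\<^sub>C g (r i t)) \<le> 2 * cmod (h t) * K" for i t
      unfolding norm_scaleC by (intro mult_mono a K) auto
  qed
qed

lemma borel_measurable_lebesgue_continuous: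
  fixes f :: "'a::euclidean_space \<Rightarrow> 'b::topological_space"
  shows "continuous_on UNIV f \<Longrightarrow> f \<in> borel_measurable lebesgue"
  by (intro measurable_completion) (simp add: borel_measurable_continuous_onI)

lemma continuous_on_translate_slice:
  fixes F :: "'a::real_normed_vector \<times> 'b::topological_space \<Rightarrow> 'c::topological_space"
  assumes "continuous_on UNIV F"
  shows "continuous_on UNIV (\<lambda>\<sigma>. F (t - \<sigma>, x))"
  by (rule continuous_on_compose2[OF assms]) (auto intro!: continuous_intros)

lemma bochner_integrable_convolution:
  fixes F :: "(real ^ 'n) \<times> 'x::topological_space \<Rightarrow> 'y::complex_banach"
  assumes "integrable lebesgue h" and "continuous_on UNIV F" and "\<And>t. norm (F (t, x)) \<le> K"
  shows "bochner_integrable lebesgue (\<lambda>\<sigma>. h \<sigma> *\<^sub>C F (t - \<sigma>, x))"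
  by (rule bochner_integrable_scaleC_continuous[where K = K]) (use assms in \<open>auto intro: continuous_on_translate_slice\<close>)

lemma has_bochner_int_convolution:
  fixes F :: "(real ^ 'n) \<times> 'x::topological_space \<Rightarrow> 'y::complex_banach"
  assumes "integrable lebesgue h" and "continuous_on UNIV F" and "\<And>t. norm (F (t, x)) \<le> K"
  shows "has_bochner_int lebesgue (\<lambda>\<sigma>. h \<sigma> *\<^sub>C F (t - \<sigma>, x)) (convolution h F (t, x))"
  unfolding convolution_def prod.case
  by (rule has_bochner_int_bochner_int[OF bochner_integrable_convolution[OF assms]])

lemma norm_convolution_le:
  fixes F :: "(real ^ 'n) \<times> 'x::topological_space \<Rightarrow> 'y::complex_banach"
  assumes h: "integrable lebesgue h" and F: "continuous_on UNIV F" and K: "\<And>t. norm (F (t, x)) \<le> K"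
  shows "norm (convolution h F (t, x)) \<le> (\<integral>\<sigma>. cmod (h \<sigma>) * K \<partial>lebesgue)"
proof -
  \<comment> \<open>Subtracting 0 turns the bound into a comparison with the zero integrand.\<close>
  have "norm (convolution h F (t, x) - 0) \<le> (\<integral>\<sigma>. cmod (h \<sigma>) * K \<partial>lebesgue)"
  proof (rule has_bochner_int_norm_diff_le[OF has_bochner_int_convolution[OF h F K] has_bochner_int_zero])
    show "integrable lebesgue (\<lambda>\<sigma>. cmod (h \<sigma>) * K)"
      using h by auto
    show "norm (h \<sigma> *\<^sub>C F (t - \<sigma>, x) - 0) \<le> cmod (h \<sigma>) * K" for \<sigma>
      by (simp add: norm_scaleC K mult_left_mono)
  qed
  then show ?thesis by simp
qed

text \<open>Dominated convergence is applied to the real-valued norm of the difference of the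
  integrands, and the difference estimate carries the result over to the convolutions. The local
  bound must be uniform in \<open>t\<close>, since \<open>t - \<sigma>\<close> runs through the
  whole space.\<close>

lemma continuous_on_convolution:
  fixes F :: "(real ^ 'n) \<times> 'x::metric_space \<Rightarrow> 'y::complex_banach"
  assumes h: "integrable lebesgue h" and F: "continuous_on UNIV F"
    and loc: "\<And>x. \<exists>e>0. \<exists>K. \<forall>t. \<forall>y\<in>ball x e. norm (F (t, y)) \<le> K"
  shows "continuous_on UNIV (convolution h F)"
  unfolding continuous_on_eq_continuous_at[OF open_UNIV]
proof (intro ballI continuous_at_sequentiallyI)
  fix a :: "(real ^ 'n) \<times> 'x" and u assume u: "u \<longlonglongrightarrow> a"
  obtain t x where a: "a = (t, x)" by (cases a)
  obtain e K where e: "e > 0" and K: "\<And>t y. y \<in> ball x e \<Longrightarrow> norm (F (t, y)) \<le> K"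
    using loc[of x] by blast
  have "\<forall>\<^sub>F n in sequentially. snd (u n) \<in> ball x e"
    using tendsto_snd[OF u] e by (intro topological_tendstoD) (auto simp: a)
  then obtain N where N: "\<And>n. n \<ge> N \<Longrightarrow> snd (u n) \<in> ball x e"
    by (auto simp: eventually_sequentially)
  \<comment> \<open>Dropping the first \<open>N\<close> terms keeps every second component in the
    ball, so \<open>K\<close> applies at every index.\<close>
  define v where "v n = u (n + N)" for n
  have v: "v \<longlonglongrightarrow> a"
    unfolding v_def by (rule LIMSEQ_ignore_initial_segment[OF u])
  have v_ball: "snd (v n) \<in> ball x e" for n
    unfolding v_def by (rule N) simp
  define p where "p n \<sigma> = cmod (h \<sigma>) * norm (F (fst (v n) - \<sigma>, snd (v n)) - F (t - \<sigma>, x))" for n \<sigma>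
  \<comment> \<open>Measurability comes from continuity in \<open>\<sigma>\<close> of the norm of
    the difference, so no difference of merely Borel functions into the target space is
    formed.\<close>
  have p_meas: "p n \<in> borel_measurable lebesgue" for n
    unfolding p_def
  proof (rule borel_measurable_times)
    show "(\<lambda>\<sigma>. cmod (h \<sigma>)) \<in> borel_measurable lebesgue"
      by (rule borel_measurable_integrable[OF integrable_norm[OF h]])
    show "(\<lambda>\<sigma>. norm (F (fst (v n) - \<sigma>, snd (v n)) - F (t - \<sigma>, x))) \<in> borel_measurable lebesgue"
      by (intro borel_measurable_lebesgue_continuous continuous_on_norm continuous_on_diff continuous_on_translate_slice F)
  qed
  have w: "integrable lebesgue (\<lambda>\<sigma>. cmod (h \<sigma>) * (2 * K))"
    using h by auto
  have p_lim: "(\<lambda>n. p n \<sigma>) \<longlonglongrightarrow> 0" for \<sigma>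
  proof -
    have "(\<lambda>n. (fst (v n) - \<sigma>, snd (v n))) \<longlonglongrightarrow> (t - \<sigma>, x)"
      using tendsto_fst[OF v] tendsto_snd[OF v] by (auto simp: a intro!: tendsto_intros)
    then have "(\<lambda>n. F (fst (v n) - \<sigma>, snd (v n))) \<longlonglongrightarrow> F (t - \<sigma>, x)"
      by (rule continuous_on_tendsto_compose[OF F]) auto
    then have "(\<lambda>n. p n \<sigma>) \<longlonglongrightarrow> cmod (h \<sigma>) * norm (F (t - \<sigma>, x) - F (t - \<sigma>, x))"
      unfolding p_def by (intro tendsto_intros)
    then show ?thesis by simp
  qed
  have p_le: "norm (p n \<sigma>) \<le> cmod (h \<sigma>) * (2 * K)" for n \<sigma>
  proof -
    have "norm (F (fst (v n) - \<sigma>, snd (v n)) - F (t - \<sigma>, x)) \<le> 2 * K"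
      using norm_triangle_ineq4[of "F (fst (v n) - \<sigma>, snd (v n))" "F (t - \<sigma>, x)"]
        K[OF v_ball, of "fst (v n) - \<sigma>" n] K[of x "t - \<sigma>"] e by simp
    then show ?thesis
      by (simp add: p_def abs_mult mult_left_mono)
  qed
  have "(\<lambda>n. \<integral>\<sigma>. p n \<sigma> \<partial>lebesgue) \<longlonglongrightarrow> (\<integral>\<sigma>. 0 \<partial>(lebesgue :: (real ^ 'n) measure))"
    by (rule Bochner_Integration.integral_dominated_convergence[OF _ p_meas w]) (simp_all add: p_lim p_le[unfolded real_norm_def])
  then have p_int: "(\<lambda>n. \<integral>\<sigma>. p n \<sigma> \<partial>lebesgue) \<longlonglongrightarrow> 0" by simp
  have "norm (convolution h F (v n) - convolution h F (t, x)) \<le> (\<integral>\<sigma>. p n \<sigma> \<partial>lebesgue)" for n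
  proof -
    have "norm (convolution h F (fst (v n), snd (v n)) - convolution h F (t, x)) \<le> (\<integral>\<sigma>. p n \<sigma> \<partial>lebesgue)"
    proof (rule has_bochner_int_norm_diff_le)
      show "has_bochner_int lebesgue (\<lambda>\<sigma>. h \<sigma> *\<^sub>C F (fst (v n) - \<sigma>, snd (v n))) (convolution h F (fst (v n), snd (v n)))"
        by (rule has_bochner_int_convolution[OF h F K[OF v_ball]])
      show "has_bochner_int lebesgue (\<lambda>\<sigma>. h \<sigma> *\<^sub>C F (t - \<sigma>, x)) (convolution h F (t, x))"
        by (rule has_bochner_int_convolution[OF h F K]) (use e in simp)
      show "integrable lebesgue (p n)"
        by (rule Bochner_Integration.integrable_bound[OF w p_meas]) (intro AE_I2 order_trans[OF p_le], simp)
      show "norm (h \<sigma> *\<^sub>C F (fst (v n) - \<sigma>, snd (v n)) - h \<sigma> *\<^sub>C F (t - \<sigma>, x)) \<le> p n \<sigma>" for \<sigma>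
        by (simp add: p_def norm_scaleC flip: bounded_bilinear.diff_right[OF bounded_bilinear_scaleC])
    qed
    then show ?thesis by simp
  qed
  then have "\<forall>n. norm (convolution h F (v n) - convolution h F (t, x)) \<le> (\<integral>\<sigma>. p n \<sigma> \<partial>lebesgue)" ..
  from LIM_zero_cancel[OF Lim_null_comparison[OF always_eventually[OF this] p_int]]
  have "(\<lambda>n. convolution h F (v n)) \<longlonglongrightarrow> convolution h F (t, x)" .
  then show "(\<lambda>n. convolution h F (u n)) \<longlonglongrightarrow> convolution h F a"
    unfolding v_def a by (rule LIMSEQ_offset)
qed

section \<open>Tails of the kernel and the translation estimate\<close>

lemma integrable_norm_indicator_tail:
  fixes h :: "'a::euclidean_space \<Rightarrow> complex"
  assumes "integrable lebesgue h"
  shows "integrable lebesgue (\<lambda>\<sigma>. cmod (h \<sigma>) * indicator {\<sigma>. r \<le> norm \<sigma>} \<sigma>)"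
proof (rule integrable_real_mult_indicator[OF _ integrable_norm[OF assms]])
  have "{\<sigma> :: 'a. r \<le> norm \<sigma>} \<in> sets borel"
    by (intro borel_closed closed_Collect_le continuous_intros)
  then show "{\<sigma> :: 'a. r \<le> norm \<sigma>} \<in> sets lebesgue"
    by (intro sets_completionI_sets) simp
qed

text \<open>Each fixed \<open>\<sigma>\<close> eventually leaves the region of integration, and
  \<open>cmod (h \<sigma>)\<close> dominates. Integer radii keep the limit sequential; they serve
  later as the amounts added to the thresholds.\<close>

lemma integral_norm_tail_tendsto_0:
  fixes h :: "'a::euclidean_space \<Rightarrow> complex"
  assumes h: "integrable lebesgue h"
  shows "(\<lambda>k. \<integral>\<sigma>. cmod (h \<sigma>) * indicator {\<sigma>. real k \<le> norm \<sigma>} \<sigma> \<partial>lebesgue) \<longlonglongrightarrow> 0"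
proof -
  have "(\<lambda>k. \<integral>\<sigma>. cmod (h \<sigma>) * indicator {\<sigma>. real k \<le> norm \<sigma>} \<sigma> \<partial>lebesgue) \<longlonglongrightarrow> (\<integral>\<sigma>. 0 \<partial>(lebesgue :: 'a measure))"
  proof (rule Bochner_Integration.integral_dominated_convergence)
    show "integrable lebesgue (\<lambda>\<sigma>. cmod (h \<sigma>))"
      by (rule integrable_norm[OF h])
    show "(\<lambda>\<sigma>. cmod (h \<sigma>) * indicator {\<sigma>. real k \<le> norm \<sigma>} \<sigma>) \<in> borel_measurable lebesgue" for k
      by (rule borel_measurable_integrable[OF integrable_norm_indicator_tail[OF h]])
    show "AE \<sigma> in lebesgue. (\<lambda>k. cmod (h \<sigma>) * indicator {\<sigma>. real k \<le> norm \<sigma>} \<sigma>) \<longlonglongrightarrow> 0"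
    proof (rule AE_I2)
      fix \<sigma> :: 'a
      obtain N :: nat where "norm \<sigma> < real N"
        using reals_Archimedean2 by blast
      then show "(\<lambda>k. cmod (h \<sigma>) * indicator {\<sigma>. real k \<le> norm \<sigma>} \<sigma>) \<longlonglongrightarrow> 0"
        by (intro tendsto_eventually eventually_sequentiallyI[of N]) auto
    qed
    show "AE \<sigma> in lebesgue. norm (cmod (h \<sigma>) * indicator {\<sigma>. real k \<le> norm \<sigma>} \<sigma>) \<le> cmod (h \<sigma>)" for k
      by (auto simp: indicator_def)
  qed simp
  then show ?thesis by simp
qed

text \<open>For \<open>norm \<sigma> < R\<close> the reverse triangle inequality keeps
  \<open>t - \<sigma>\<close> and \<open>t + \<tau> - \<sigma>\<close> beyond \<open>M\<close>, so
  the error of \<open>F\<close> is at most \<open>\<delta>\<close>; for other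
  \<open>\<sigma>\<close> it is at most \<open>(1 + cmod c) * K\<close>. Both recurrence properties
  are transferred through this inequality.\<close>

lemma convolution_translate_diff_le:
  fixes F :: "(real ^ 'n) \<times> 'x::topological_space \<Rightarrow> 'y::complex_banach"
  assumes h: "integrable lebesgue h" and F: "continuous_on UNIV F"
    and K: "\<And>t. norm (F (t, x)) \<le> K"
    and \<delta>: "0 \<le> \<delta>" "\<And>s. norm s \<ge> M \<Longrightarrow> norm (s + \<tau>) \<ge> M \<Longrightarrow> norm (F (s + \<tau>, x) - c *\<^sub>C F (s, x)) \<le> \<delta>"
    and t: "norm t \<ge> M + R" "norm (t + \<tau>) \<ge> M + R"
  shows "norm (convolution h F (t + \<tau>, x) - c *\<^sub>C convolution h F (t, x)) \<le>
    \<delta> * (\<integral>\<sigma>. cmod (h \<sigma>) \<partial>lebesgue) +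
    (1 + cmod c) * K * (\<integral>\<sigma>. cmod (h \<sigma>) * indicator {\<sigma>. R \<le> norm \<sigma>} \<sigma> \<partial>lebesgue)"
    (is "_ \<le> ?bound")
proof -
  let ?C = "(1 + cmod c) * K"
  \<comment> \<open>The term with \<open>\<delta>\<close> is kept for all \<open>\<sigma>\<close>,
    so that a single indicator suffices.\<close>
  let ?p = "\<lambda>\<sigma>. \<delta> * cmod (h \<sigma>) + ?C * (cmod (h \<sigma>) * indicator {\<sigma>. R \<le> norm \<sigma>} \<sigma>)"
  have K0: "0 \<le> K"
    using order_trans[OF norm_ge_zero K] .
  have int1: "integrable lebesgue (\<lambda>\<sigma>. \<delta> * cmod (h \<sigma>))"
    by (intro integrable_mult_right integrable_norm h)
  have int2: "integrable lebesgue (\<lambda>\<sigma>. ?C * (cmod (h \<sigma>) * indicator {\<sigma>. R \<le> norm \<sigma>} \<sigma>))"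
    by (intro integrable_mult_right integrable_norm_indicator_tail h)
  have "norm (convolution h F (t + \<tau>, x) - c *\<^sub>C convolution h F (t, x)) \<le> (\<integral>\<sigma>. ?p \<sigma> \<partial>lebesgue)"
  proof (rule has_bochner_int_norm_diff_le)
    show "has_bochner_int lebesgue (\<lambda>\<sigma>. h \<sigma> *\<^sub>C F (t + \<tau> - \<sigma>, x)) (convolution h F (t + \<tau>, x))"
      by (rule has_bochner_int_convolution[OF h F K])
    show "has_bochner_int lebesgue (\<lambda>\<sigma>. c *\<^sub>C (h \<sigma> *\<^sub>C F (t - \<sigma>, x))) (c *\<^sub>C convolution h F (t, x))"
      by (rule has_bochner_int_bounded_linear[OF bounded_bilinear.bounded_linear_right[OF bounded_bilinear_scaleC]
          has_bochner_int_convolution[OF h F K]])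
    show "integrable lebesgue ?p"
      by (intro Bochner_Integration.integrable_add int1 int2)
    fix \<sigma>
    let ?d = "norm (F (t + \<tau> - \<sigma>, x) - c *\<^sub>C F (t - \<sigma>, x))"
    have "?d \<le> \<delta> + ?C * indicator {\<sigma>. R \<le> norm \<sigma>} \<sigma>"
    proof (cases "R \<le> norm \<sigma>")
      case True
      have "?d \<le> K + cmod c * K"
        using norm_triangle_ineq4[of "F (t + \<tau> - \<sigma>, x)" "c *\<^sub>C F (t - \<sigma>, x)"] K[of "t + \<tau> - \<sigma>"]
          mult_left_mono[OF K[of "t - \<sigma>"], of "cmod c"] by (simp add: norm_scaleC)
      then show ?thesis
        using True \<delta>(1) by (simp add: algebra_simps)
    next
      case False
      have "norm (t - \<sigma>) \<ge> M" "norm (t - \<sigma> + \<tau>) \<ge> M"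
        using t False norm_triangle_ineq2[of t \<sigma>] norm_triangle_ineq2[of "t + \<tau>" \<sigma>]
        by (auto simp: algebra_simps)
      from \<delta>(2)[OF this] False show ?thesis
        by (simp add: algebra_simps)
    qed
    then have "cmod (h \<sigma>) * ?d \<le> cmod (h \<sigma>) * (\<delta> + ?C * indicator {\<sigma>. R \<le> norm \<sigma>} \<sigma>)"
      by (rule mult_left_mono) simp
    \<comment> \<open>Commutativity of complex multiplication lets \<open>c\<close> pass the factor
      \<open>h \<sigma>\<close>.\<close>
    moreover have "h \<sigma> *\<^sub>C F (t + \<tau> - \<sigma>, x) - c *\<^sub>C (h \<sigma> *\<^sub>C F (t - \<sigma>, x)) =
        h \<sigma> *\<^sub>C (F (t + \<tau> - \<sigma>, x) - c *\<^sub>C F (t - \<sigma>, x))"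
      by (simp add: bounded_bilinear.diff_right[OF bounded_bilinear_scaleC] scaleC_scaleC mult.commute)
    ultimately show "norm (h \<sigma> *\<^sub>C F (t + \<tau> - \<sigma>, x) - c *\<^sub>C (h \<sigma> *\<^sub>C F (t - \<sigma>, x))) \<le> ?p \<sigma>"
      by (simp add: norm_scaleC algebra_simps)
  qed
  also have "\<dots> = ?bound"
    by (subst Bochner_Integration.integral_add[OF int1 int2]) (simp only: integral_mult_right_zero)
  finally show ?thesis .
qed

section \<open>Transfer of almost periodicity and uniform recurrence\<close>

lemma quasi_asymptotically_almost_periodic_convolution:
  fixes F :: "(real ^ 'n) \<times> 'x::complex_banach \<Rightarrow> 'y::complex_banach"
  assumes h: "integrable lebesgue h" and conv: "continuous_on UNIV (convolution h F)"
    and bnd: "\<And>B. B \<in> \<B> \<Longrightarrow> \<exists>K. \<forall>t. \<forall>x\<in>B. norm (F (t, x)) \<le> K"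
    and ap: "quasi_asymptotically_almost_periodic \<B> I' c F"
  shows "quasi_asymptotically_almost_periodic \<B> I' c (convolution h F)"
  unfolding quasi_asymptotically_almost_periodic_def
proof (intro conjI ballI allI impI)
  show "continuous_on UNIV (convolution h F)" by fact
  have F: "continuous_on UNIV F"
    using ap by (simp add: quasi_asymptotically_almost_periodic_def)
  fix B and \<epsilon> :: real assume B: "B \<in> \<B>" and \<epsilon>: "\<epsilon> > 0"
  obtain K where K: "\<And>t x. x \<in> B \<Longrightarrow> norm (F (t, x)) \<le> K"
    using bnd[OF B] by blast
  define H where "H = (\<integral>\<sigma>. cmod (h \<sigma>) \<partial>lebesgue)"
  define T where "T k = (\<integral>\<sigma>. cmod (h \<sigma>) * indicator {\<sigma>. real k \<le> norm \<sigma>} \<sigma> \<partial>lebesgue)" for k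
  have H: "0 \<le> H"
    unfolding H_def by (rule Bochner_Integration.integral_nonneg) simp
  \<comment> \<open>The summand 1 keeps the denominator positive when \<open>H = 0\<close>; half of
    \<open>\<epsilon>\<close> is reserved for the tail.\<close>
  define \<delta> where "\<delta> = \<epsilon> / (2 * (H + 1))"
  have \<delta>: "\<delta> > 0" "\<delta> * H \<le> \<epsilon> / 2"
    using H \<epsilon> by (auto simp: \<delta>_def field_simps)
  have "(\<lambda>k. (1 + cmod c) * K * T k) \<longlonglongrightarrow> (1 + cmod c) * K * 0"
    unfolding T_def by (intro tendsto_intros integral_norm_tail_tendsto_0 h)
  then have "\<forall>\<^sub>F k in sequentially. (1 + cmod c) * K * T k < \<epsilon> / 2"
    using \<epsilon> by (intro order_tendstoD(2)) auto
  \<comment> \<open>\<open>R\<close> is fixed before \<open>t0\<close> and \<open>\<tau>\<close> are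
    chosen and does not depend on them.\<close>
  then obtain R where R: "(1 + cmod c) * K * T R < \<epsilon> / 2"
    by (auto simp: eventually_sequentially)
  from conjunct2[OF ap[unfolded quasi_asymptotically_almost_periodic_def], THEN bspec, OF B, THEN spec, THEN mp, OF \<delta>(1)]
  obtain l where l: "l > 0" "\<forall>t0\<in>I'. \<exists>\<tau>\<in>cball t0 l \<inter> I'. \<exists>M>0. \<forall>t. \<forall>x\<in>B.
      norm t \<ge> M \<and> norm (t + \<tau>) \<ge> M \<longrightarrow> norm (F (t + \<tau>, x) - c *\<^sub>C F (t, x)) \<le> \<delta>"
    by (elim exE conjE)
  show "\<exists>l>0. \<forall>t\<^sub>0\<in>I'. \<exists>\<tau>\<in>cball t\<^sub>0 l \<inter> I'. \<exists>M>0. \<forall>t. \<forall>x\<in>B. norm t \<ge> M \<and> norm (t + \<tau>) \<ge> M \<longrightarrow>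
        norm (convolution h F (t + \<tau>, x) - c *\<^sub>C convolution h F (t, x)) \<le> \<epsilon>"
  \<comment> \<open>The length \<open>l\<close> belonging to \<open>\<delta>\<close> is kept, and so
    is each \<open>\<tau>\<close> found for \<open>F\<close>; only the threshold changes.\<close>
  proof (intro exI[of _ l] conjI ballI l(1))
    fix t0 assume "t0 \<in> I'"
    from bspec[OF l(2) this] obtain \<tau> M where \<tau>: "\<tau> \<in> cball t0 l \<inter> I'" and M: "M > 0"
      and FM: "\<And>t x. x \<in> B \<Longrightarrow> norm t \<ge> M \<Longrightarrow> norm (t + \<tau>) \<ge> M \<Longrightarrow> norm (F (t + \<tau>, x) - c *\<^sub>C F (t, x)) \<le> \<delta>"
      by blast
    show "\<exists>\<tau>\<in>cball t0 l \<inter> I'. \<exists>M>0. \<forall>t. \<forall>x\<in>B. norm t \<ge> M \<and> norm (t + \<tau>) \<ge> M \<longrightarrow>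
        norm (convolution h F (t + \<tau>, x) - c *\<^sub>C convolution h F (t, x)) \<le> \<epsilon>"
    proof (intro bexI[OF _ \<tau>] exI[of _ "M + real R"] conjI allI ballI impI)
      show "M + real R > 0" using M by simp
      fix t x assume x: "x \<in> B" and t: "norm t \<ge> M + real R \<and> norm (t + \<tau>) \<ge> M + real R"
      have "norm (convolution h F (t + \<tau>, x) - c *\<^sub>C convolution h F (t, x)) \<le> \<delta> * H + (1 + cmod c) * K * T R"
        unfolding H_def T_def
        by (rule convolution_translate_diff_le[OF h F K[OF x] less_imp_le[OF \<delta>(1)] FM[OF x] conjunct1[OF t] conjunct2[OF t]])
      with \<delta>(2) R show "norm (convolution h F (t + \<tau>, x) - c *\<^sub>C convolution h F (t, x)) \<le> \<epsilon>"
        by linarith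
    qed
  qed
qed

text \<open>The sequence \<open>\<tau>\<close> is kept and \<open>M k\<close> becomes
  \<open>M k + real k\<close>. The radius has to grow with the index, so that the tail integral
  tends to 0 together with the error of \<open>F\<close>.\<close>

lemma quasi_asymptotically_uniformly_recurrent_convolution:
  fixes F :: "(real ^ 'n) \<times> 'x::complex_banach \<Rightarrow> 'y::complex_banach"
  assumes h: "integrable lebesgue h" and conv: "continuous_on UNIV (convolution h F)"
    and bnd: "\<And>B. B \<in> \<B> \<Longrightarrow> \<exists>K. \<forall>t. \<forall>x\<in>B. norm (F (t, x)) \<le> K"
    and ur: "quasi_asymptotically_uniformly_recurrent \<B> I' c F"
  shows "quasi_asymptotically_uniformly_recurrent \<B> I' c (convolution h F)"
  unfolding quasi_asymptotically_uniformly_recurrent_def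
proof (intro conjI ballI)
  show "continuous_on UNIV (convolution h F)" by fact
  have F: "continuous_on UNIV F"
    using ur by (simp add: quasi_asymptotically_uniformly_recurrent_def)
  \<comment> \<open>Taking the function and the threshold as parameters lets one expression serve
    both \<open>F\<close> at \<open>M k\<close> and the convolution at
    \<open>M k + real k\<close>.\<close>
  define S where "S G \<tau> M B = (SUP (t, x) \<in> {t. norm t \<ge> M \<and> norm (t + \<tau>) \<ge> M} \<times> B.
    ennreal (norm (G (t + \<tau>, x) - c *\<^sub>C G (t, x))))"
    for G :: "(real ^ 'n) \<times> 'x \<Rightarrow> 'y" and \<tau> and M :: real and B
  fix B assume B: "B \<in> \<B>"
  obtain K where K: "\<And>t x. x \<in> B \<Longrightarrow> norm (F (t, x)) \<le> K"
    using bnd[OF B] by blast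
  define H where "H = (\<integral>\<sigma>. cmod (h \<sigma>) \<partial>lebesgue)"
  define T where "T k = (\<integral>\<sigma>. cmod (h \<sigma>) * indicator {\<sigma>. real k \<le> norm \<sigma>} \<sigma> \<partial>lebesgue)" for k
  from conjunct2[OF ur[unfolded quasi_asymptotically_uniformly_recurrent_def], THEN bspec, OF B]
  obtain \<tau> M where "\<forall>k. \<tau> k \<in> I'" "\<forall>k. M k > 0"
    and \<tau>_lim: "filterlim (\<lambda>k. norm (\<tau> k)) at_top sequentially"
    and M_lim: "filterlim M at_top sequentially"
    and S: "(\<lambda>k. S F (\<tau> k) (M k) B) \<longlonglongrightarrow> 0"
    unfolding S_def by (elim exE conjE)
  then have \<tau>: "\<tau> k \<in> I'" and M: "M k > 0" for k
    by blast+
  \<comment> \<open>\<open>enn2real\<close> sends infinity to 0, so \<open>\<delta> k\<close>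
    controls the error of \<open>F\<close> only where the supremum is finite. This holds for all
    large \<open>k\<close>, which is enough for the limit.\<close>
  define \<delta> where "\<delta> k = enn2real (S F (\<tau> k) (M k) B)" for k
  have "\<delta> \<longlonglongrightarrow> 0"
    unfolding \<delta>_def using S by (intro tendsto_enn2real) simp_all
  then have "(\<lambda>k. ennreal (\<delta> k * H + (1 + cmod c) * K * T k)) \<longlonglongrightarrow> ennreal (0 * H + (1 + cmod c) * K * 0)"
    unfolding T_def by (intro tendsto_intros tendsto_ennrealI integral_norm_tail_tendsto_0 h) simp
  then have lim: "(\<lambda>k. ennreal (\<delta> k * H + (1 + cmod c) * K * T k)) \<longlonglongrightarrow> 0"
    by simp
  have fin: "\<forall>\<^sub>F k in sequentially. S F (\<tau> k) (M k) B < \<infinity>"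
    using S by (rule order_tendstoD(2)) simp
  have le: "S (convolution h F) (\<tau> k) (M k + real k) B \<le> ennreal (\<delta> k * H + (1 + cmod c) * K * T k)"
    if k: "S F (\<tau> k) (M k) B < \<infinity>" for k
    unfolding S_def
  proof (rule SUP_least, clarify)
    fix t x assume x: "x \<in> B" and t: "M k + real k \<le> norm t" "M k + real k \<le> norm (t + \<tau> k)"
    have "norm (F (s + \<tau> k, x) - c *\<^sub>C F (s, x)) \<le> \<delta> k" if "norm s \<ge> M k" "norm (s + \<tau> k) \<ge> M k" for s
    proof -
      have "ennreal (norm (F (s + \<tau> k, x) - c *\<^sub>C F (s, x))) \<le> S F (\<tau> k) (M k) B"
        unfolding S_def by (rule SUP_upper2[of "(s, x)"]) (use x that in auto)
      also have "\<dots> = ennreal (\<delta> k)"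
        using k by (simp add: \<delta>_def)
      finally show ?thesis
        by (simp add: \<delta>_def)
    qed
    then have "norm (convolution h F (t + \<tau> k, x) - c *\<^sub>C convolution h F (t, x)) \<le> \<delta> k * H + (1 + cmod c) * K * T k"
      unfolding H_def T_def
      by (intro convolution_translate_diff_le[where M = "M k"] h F K x t) (simp_all add: \<delta>_def)
    then show "ennreal (norm (convolution h F (t + \<tau> k, x) - c *\<^sub>C convolution h F (t, x)))
        \<le> ennreal (\<delta> k * H + (1 + cmod c) * K * T k)"
      by (rule ennreal_leI)
  qed
  have S_conv: "(\<lambda>k. S (convolution h F) (\<tau> k) (M k + real k) B) \<longlonglongrightarrow> 0"
  proof (rule tendsto_sandwich[OF _ _ tendsto_const lim])
    show "\<forall>\<^sub>F k in sequentially. S (convolution h F) (\<tau> k) (M k + real k) B \<le> ennreal (\<delta> k * H + (1 + cmod c) * K * T k)"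
      using fin by (rule eventually_mono) (rule le)
  qed simp
  have M': "filterlim (\<lambda>k. M k + real k) at_top sequentially"
    by (rule filterlim_at_top_add_at_top[OF M_lim filterlim_real_sequentially])
  have M'_pos: "M k + real k > 0" for k
    using M[of k] by simp
  show "\<exists>\<tau> M. (\<forall>k. \<tau> k \<in> I') \<and> (\<forall>k. M k > 0) \<and>
      filterlim (\<lambda>k. norm (\<tau> k)) at_top sequentially \<and> filterlim M at_top sequentially \<and>
      (\<lambda>k. SUP (t, x) \<in> {t. norm t \<ge> M k \<and> norm (t + \<tau> k) \<ge> M k} \<times> B.
        ennreal (norm (convolution h F (t + \<tau> k, x) - c *\<^sub>C convolution h F (t, x)))) \<longlonglongrightarrow> 0"
    by (rule exI[of _ \<tau>], rule exI[of _ "\<lambda>k. M k + real k"])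
      (intro conjI allI \<tau> \<tau>_lim M' M'_pos S_conv[unfolded S_def])
qed

section \<open>Enlarged sets and finite suprema\<close>

lemma subset_enlargement:
  assumes "e \<ge> 0"
  shows "B \<subseteq> enlargement e B"
  using assms closure_subset[of B] by (force simp: enlargement_def frontier_def)

text \<open>A point of \<open>B\<close> outside the interior lies on the frontier, so the closed
  ball of radius \<open>e\<close> about it is part of the enlargement. Bounds on the enlargement
  thus hold near each point of \<open>B\<close>.\<close>

lemma enlargement_nhd:
  assumes "x \<in> B" "e > 0"
  shows "\<exists>d>0. ball x d \<subseteq> enlargement e B"
proof (cases "x \<in> interior B")
  case True
  then obtain d where "d > 0" "ball x d \<subseteq> interior B"
    using open_contains_ball[of "interior B"] by auto
  then show ?thesis
    by (auto simp: enlargement_def)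
next
  case False
  with assms(1) closure_subset[of B] have "x \<in> frontier B"
    by (auto simp: frontier_def)
  then have "ball x e \<subseteq> enlargement e B"
    using ball_subset_cball[of x e] by (auto simp: enlargement_def)
  with assms(2) show ?thesis by blast
qed

text \<open>Translates between the extended suprema of the theorem and the real bounds
  \<open>K\<close> of the estimates; a finite supremum is itself such a bound.\<close>

lemma SUP_ennreal_norm_finite_iff:
  "(SUP (t, x) \<in> A \<times> B. ennreal (norm (f (t, x)))) < \<infinity> \<longleftrightarrow> (\<exists>K. \<forall>t\<in>A. \<forall>x\<in>B. norm (f (t, x)) \<le> K)"
    (is "?S < \<infinity> \<longleftrightarrow> _")
proof
  assume fin: "?S < \<infinity>"
  show "\<exists>K. \<forall>t\<in>A. \<forall>x\<in>B. norm (f (t, x)) \<le> K"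
  proof (intro exI ballI)
    fix t x assume "t \<in> A" "x \<in> B"
    then have "ennreal (norm (f (t, x))) \<le> ?S"
      by (intro SUP_upper2[of "(t, x)"]) auto
    also have "?S = ennreal (enn2real ?S)"
      using fin by simp
    finally show "norm (f (t, x)) \<le> enn2real ?S"
      by (simp only: ennreal_le_iff[OF enn2real_nonneg])
  qed
next
  assume "\<exists>K. \<forall>t\<in>A. \<forall>x\<in>B. norm (f (t, x)) \<le> K"
  then obtain K where K: "\<And>t x. t \<in> A \<Longrightarrow> x \<in> B \<Longrightarrow> norm (f (t, x)) \<le> K" by blast
  have "?S \<le> ennreal K"
    by (rule SUP_least) (auto intro: ennreal_leI K)
  then show "?S < \<infinity>"
    by (rule le_less_trans) simp
qed

theorem theorem3p6:
  fixes h :: "real ^ 'n \<Rightarrow> complex"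
    and I' :: "(real ^ 'n) set"
    and c :: complex
    and \<B> :: "'x::complex_banach set set"
    and F :: "(real ^ 'n) \<times> 'x \<Rightarrow> 'y::complex_banach"
    and \<epsilon> :: "'x set \<Rightarrow> real"
  assumes \<B>_nonempty: "\<And>B. B \<in> \<B> \<Longrightarrow> B \<noteq> {}"
    and \<B>_covers: "\<And>x. \<exists>B\<in>\<B>. x \<in> B"
    and h_L1: "integrable lebesgue h"
    and I'_nonempty: "I' \<noteq> {}"
    and I'_unbounded: "\<not> bounded I'"
    and c_nonzero: "c \<noteq> 0"
    and F_continuous: "continuous_on UNIV F"
    and \<epsilon>_pos: "\<And>B. B \<in> \<B> \<Longrightarrow> \<epsilon> B > 0"
    and F_bounded: "\<And>B. B \<in> \<B> \<Longrightarrow>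
      (SUP (t, x) \<in> UNIV \<times> enlargement (\<epsilon> B) B. ennreal (norm (F (t, x)))) < \<infinity>"
  shows "(\<forall>t x. bochner_integrable lebesgue (\<lambda>\<sigma>. h \<sigma> *\<^sub>C F (t - \<sigma>, x))) \<and>
    (\<forall>B\<in>\<B>. (SUP (t, x) \<in> UNIV \<times> enlargement (\<epsilon> B) B.
      ennreal (norm (convolution h F (t, x)))) < \<infinity>) \<and>
    (quasi_asymptotically_almost_periodic \<B> I' c F \<longrightarrow>
      quasi_asymptotically_almost_periodic \<B> I' c (convolution h F)) \<and>
    (quasi_asymptotically_uniformly_recurrent \<B> I' c F \<longrightarrow>
      quasi_asymptotically_uniformly_recurrent \<B> I' c (convolution h F))"
proof -
  have "\<exists>K. \<forall>t. \<forall>x\<in>enlargement (\<epsilon> B) B. norm (F (t, x)) \<le> K" if "B \<in> \<B>" for B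
    using F_bounded[OF that, unfolded SUP_ennreal_norm_finite_iff] by blast
  then obtain K where K: "\<And>B t x. B \<in> \<B> \<Longrightarrow> x \<in> enlargement (\<epsilon> B) B \<Longrightarrow> norm (F (t, x)) \<le> K B"
    by metis
  have sub: "B \<subseteq> enlargement (\<epsilon> B) B" if "B \<in> \<B>" for B
    using subset_enlargement[of "\<epsilon> B" B] \<epsilon>_pos[OF that] by simp
  have bnd: "\<exists>K. \<forall>t. \<forall>x\<in>B. norm (F (t, x)) \<le> K" if "B \<in> \<B>" for B
    using K[OF that] sub[OF that] by blast
  \<comment> \<open>Since \<open>\<B>\<close> covers the space, every \<open>x\<close> lies in some
    \<open>B\<close>, whose enlargement contains a ball about \<open>x\<close>.\<close>
  have loc: "\<exists>e>0. \<exists>K. \<forall>t. \<forall>y\<in>ball x e. norm (F (t, y)) \<le> K" for x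
  proof -
    obtain B where B: "B \<in> \<B>" "x \<in> B"
      using \<B>_covers by blast
    obtain d where "d > 0" "ball x d \<subseteq> enlargement (\<epsilon> B) B"
      using enlargement_nhd[OF B(2) \<epsilon>_pos[OF B(1)]] by blast
    with K[OF B(1)] show ?thesis by blast
  qed
  have cont: "continuous_on UNIV (convolution h F)"
    by (rule continuous_on_convolution[OF h_L1 F_continuous loc])
  show ?thesis
  proof (intro conjI allI ballI impI)
    fix t x
    obtain B where B: "B \<in> \<B>" "x \<in> B"
      using \<B>_covers by blast
    show "bochner_integrable lebesgue (\<lambda>\<sigma>. h \<sigma> *\<^sub>C F (t - \<sigma>, x))"
      by (rule bochner_integrable_convolution[OF h_L1 F_continuous K[OF B(1)]]) (use B sub in blast)
  next
    fix B assume B: "B \<in> \<B>"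
    \<comment> \<open>The bound on \<open>F\<close> is uniform in \<open>t\<close> at each point of
      the enlargement, so the same integral bounds the convolution on all of it.\<close>
    have "norm (convolution h F (t, x)) \<le> (\<integral>\<sigma>. cmod (h \<sigma>) * K B \<partial>lebesgue)"
      if "x \<in> enlargement (\<epsilon> B) B" for t x
      by (rule norm_convolution_le[OF h_L1 F_continuous K[OF B that]])
    then show "(SUP (t, x) \<in> UNIV \<times> enlargement (\<epsilon> B) B. ennreal (norm (convolution h F (t, x)))) < \<infinity>"
      unfolding SUP_ennreal_norm_finite_iff by blast
  next
    show "quasi_asymptotically_almost_periodic \<B> I' c F \<Longrightarrow> quasi_asymptotically_almost_periodic \<B> I' c (convolution h F)"
      by (rule quasi_asymptotically_almost_periodic_convolution[OF h_L1 cont bnd])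
    show "quasi_asymptotically_uniformly_recurrent \<B> I' c F \<Longrightarrow> quasi_asymptotically_uniformly_recurrent \<B> I' c (convolution h F)"
      by (rule quasi_asymptotically_uniformly_recurrent_convolution[OF h_L1 cont bnd])
  qed
qed

end
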